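(* Let $n\ge 3$ and consider the partially asymmetric $n$-player zero-sum game with two strategic variables $t_i\in T$, $s_i\in S$ described in the context, in which Players $1,\dots,n-1$ are symmetric and Player $n$ may have a different payoff function. The equilibrium where all players choose $s_i$'s is equivalent to the equilibrium where Player $n$ chooses $t_n$ and all other players choose $s_i$'s as their strategic variables, in the following sense. Write $v_i(s_1,\dots,s_n)=u_i(g_1(s_1,\dots,s_n),\dots,g_n(s_1,\dots,s_n))$. Let $s^*\in S$, $s_n^*\in S$ and put $t_n^0=g_n(s^*,\dots,s^*,s_n^* )$, so that $s_n(s^*,\dots,s^*,t_n^0)=s_n^*$. Then $(s^*,\dots,s^*,s_n^* )$ is a Nash equilibrium of the game in which every player $i\in N$ chooses $s_i$, i.e. $$v_i(s^*,\dots,s^*,s_n^* )=\max_{s_i\in S}v_i(s^*,\dots,s_i,\dots,s^*,s_n^* )\ \text{ for all } i\neq n,\qquad v_n(s^*,\dots,s^*,s_n^* )=\max_{s_n\in S}v_n(s^*,\dots,s^*,s_n),$$ if and only if $(s^*,\dots,s^*,t_n^0)$ is a Nash equilibrium of the game in which Players $1,\dots,n-1$ choose $s_1,\dots,s_{n-1}$ and Player $n$ chooses $t_n$, i.e. $$v_i(s^*,\dots,s^*,s_n^* )=\max_{s_i\in S}v_i\big(s^*,\dots,s_i,\dots,s^*,\,s_n(s^*,\dots,s_i,\dots,s^*,t_n^0)\big)\ \text{ for all } i\neq n,$$ $$v_n(s^*,\dots,s^*,s_n^* )=\max_{t_n\in T}v_n\big(s^*,\dots,s^*,\,s_n(s^*,\dots,s^*,t_n)\big).$$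 Here, in expressions indexed by $i\neq n$, $s_i$ stands in the $i$-th position.
   Context: Setting. $N=\{1,\dots,n\}$ is the set of players, $n\ge 3$. Each player $i$ has two strategic variables $t_i\in T$ and $s_i\in S$, where $T$ and $S$ are non-empty convex compact subsets of (Hausdorff) linear topological spaces, the same for all players. The variables are related by $s_i=f_i(t_1,\dots,t_n)$ and $t_i=g_i(s_1,\dots,s_n)$, $i\in N$, where $(f_1,\dots,f_n):T^n\to S^n$ is a continuous bijection with continuous inverse $(g_1,\dots,g_n)$. When only Player $n$ chooses $t_n$ and the others choose $s_1,\dots,s_{n-1}$, the value of $s_n$ is determined by $t_n=g_n(s_1,\dots,s_n)$; it is denoted $s_n(s_1,\dots,s_{n-1},t_n)$. It is assumed that this determines a unique $s_n\in S$ for all $s_1,\dots,s_{n-1}\in S$ and $t_n\in T$, and that, for fixed $s_1,\dots,s_{n-1}$, the map $s_n\mapsto g_n(s_1,\dots,s_{n-1},s_n)$ is a bijection from $S$ onto $T$. Payoffs. Player $i$'s payoff is $u_i(t_1,\dots,t_n)$, with $u_i:T^n\to\mathbb{R}$ continuous (hence $v_i$ is continuous on $S^n$). For each $i$, the payoff of player $i$ is quasi-concave in player $i$'s own strategic variable when the other players' strategic variables are fixed, and, for each $j\ne i$, quasi-convex in player $j$'s strategic variable when the other players' strategic variables are fixed. This holds in each of the following systems of chosen variables: all $t$'s, $(t_1,\dots,t_n)$; all $s$'s, $(s_1,\dots,s_n)$; and $(s_1,\dots,s_{n-1},t_n)$. No differentiability is assumed. Zero-sum: $\sum_{i=1}^n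 u_i(t_1,\dots,t_n)=0$ for all $(t_1,\dots,t_n)\in T^n$. Symmetry of Players $1,\dots,n-1$: these players have the same payoff functions and are interchangeable in the payoff function of each player, whether payoffs are expressed in the $t$'s or in the $s$'s. That is, for every permutation $\sigma$ of $N$ with $\sigma(n)=n$: if $t'_{\sigma(j)}=t_j$ for all $j$, then $u_{\sigma(i)}(t'_1,\dots,t'_n)=u_i(t_1,\dots,t_n)$ for all $i\in N$; and if $s'_{\sigma(j)}=s_j$ for all $j$, then $v_{\sigma(i)}(s'_1,\dots,s'_n)=v_i(s_1,\dots,s_n)$ for all $i\in N$. Single-valuedness: for each $s\in S$ the maximizer $\arg\max_{s_n\in S}v_n(s,\dots,s,s_n)$ is unique, and it is a continuous function of $s$. *)

theory Defs
  imports "HOL-Analysis.Analysis" "HOL-Combinatorics.Permutations"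
begin

text \<open>Hausdorff real topological vector spaces. Joint continuity of scalar multiplication is
  phrased like the library's axiom for addition in \<^class>\<open>topological_monoid_add\<close>.\<close>

class hausdorff_tvs = real_vector + topological_ab_group_add + t2_space +
  assumes tendsto_scaleR_Pair: "LIM p (nhds c \<times>\<^sub>F nhds x). fst p *\<^sub>R snd p :> nhds (c *\<^sub>R x)"

instance real_normed_vector < hausdorff_tvs
proof
  fix c :: real and x :: 'a
  show "LIM p (nhds c \<times>\<^sub>F nhds x). fst p *\<^sub>R snd p :> nhds (c *\<^sub>R x)"
    unfolding nhds_prod[symmetric]
    using tendsto_fst[OF filterlim_ident, of "(c, x)"] tendsto_snd[OF filterlim_ident, of "(c, x)"]
    by (simp add: tendsto_scaleR)
qed

definition quasiconcave_on :: "'a::real_vector set \<Rightarrow> ('a \<Rightarrow> real) \<Rightarrow> bool" where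
  "quasiconcave_on X h \<longleftrightarrow>
     (\<forall>x\<in>X. \<forall>y\<in>X. \<forall>a\<in>{0..1}. min (h x) (h y) \<le> h ((1 - a) *\<^sub>R x + a *\<^sub>R y))"

definition quasiconvex_on :: "'a::real_vector set \<Rightarrow> ('a \<Rightarrow> real) \<Rightarrow> bool" where
  "quasiconvex_on X h \<longleftrightarrow>
     (\<forall>x\<in>X. \<forall>y\<in>X. \<forall>a\<in>{0..1}. h ((1 - a) *\<^sub>R x + a *\<^sub>R y) \<le> max (h x) (h y))"

text \<open>The maximum of \<open>h\<close> over \<open>X\<close> exists and equals \<open>m\<close>.\<close>

definition is_max_over :: "real \<Rightarrow> ('a \<Rightarrow> real) \<Rightarrow> 'a set \<Rightarrow> bool" where
  "is_max_over m h X \<longleftrightarrow> m \<in> h ` X \<and> (\<forall>x\<in>X. h x \<le> m)"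

text \<open>
  The players are \<open>{1..n}\<close>. A profile of the variables of all players is an element of
  \<open>{1..n} \<rightarrow>\<^sub>E X\<close>, and a profile of players \<open>1, \<dots>, n - 1\<close> is an element of \<open>{1..<n} \<rightarrow>\<^sub>E X\<close>; both
  carry the subspace topology of the product topology on functions from \<^typ>\<open>nat\<close>. The payoff of
  player \<open>i\<close> at the profile \<open>x\<close> is written \<open>w i x\<close>.
\<close>

definition quasi_payoffs :: "nat \<Rightarrow> 'a::real_vector set \<Rightarrow> (nat \<Rightarrow> (nat \<Rightarrow> 'a) \<Rightarrow> real) \<Rightarrow> bool" where
  "quasi_payoffs n X w \<longleftrightarrow>
     (\<forall>x\<in>{1..n} \<rightarrow>\<^sub>E X. \<forall>i\<in>{1..n}.
        quasiconcave_on X (\<lambda>y. w i (x(i := y))) \<and>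
        (\<forall>j\<in>{1..n} - {i}. quasiconvex_on X (\<lambda>y. w i (x(j := y)))))"

text \<open>The same for payoffs \<open>w i s t\<close> depending on the variables \<open>s\<close> of players \<open>1, \<dots>, n - 1\<close> and
  the variable \<open>t\<close> of player \<open>n\<close>.\<close>

definition quasi_payoffs_mixed ::
    "nat \<Rightarrow> 's::real_vector set \<Rightarrow> 't::real_vector set \<Rightarrow> (nat \<Rightarrow> (nat \<Rightarrow> 's) \<Rightarrow> 't \<Rightarrow> real) \<Rightarrow> bool" where
  "quasi_payoffs_mixed n S T w \<longleftrightarrow>
     (\<forall>s\<in>{1..<n} \<rightarrow>\<^sub>E S. \<forall>t\<in>T.
        (\<forall>i\<in>{1..<n}.
           quasiconcave_on S (\<lambda>y. w i (s(i := y)) t) \<and>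
           (\<forall>j\<in>{1..<n} - {i}. quasiconvex_on S (\<lambda>y. w i (s(j := y)) t)) \<and>
           quasiconvex_on T (\<lambda>y. w i s y)) \<and>
        quasiconcave_on T (\<lambda>y. w n s y) \<and>
        (\<forall>j\<in>{1..<n}. quasiconvex_on S (\<lambda>y. w n (s(j := y)) t)))"

definition symmetric_except_last ::
    "nat \<Rightarrow> 'a set \<Rightarrow> (nat \<Rightarrow> (nat \<Rightarrow> 'a) \<Rightarrow> real) \<Rightarrow> bool" where
  "symmetric_except_last n X w \<longleftrightarrow>
     (\<forall>\<sigma>. \<sigma> permutes {1..n} \<and> \<sigma> n = n \<longrightarrow>
        (\<forall>x\<in>{1..n} \<rightarrow>\<^sub>E X. \<forall>x'\<in>{1..n} \<rightarrow>\<^sub>E X.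
           (\<forall>j\<in>{1..n}. x' (\<sigma> j) = x j) \<longrightarrow> (\<forall>i\<in>{1..n}. w (\<sigma> i) x' = w i x)))"

definition payoff_s ::
    "((nat \<Rightarrow> 's) \<Rightarrow> nat \<Rightarrow> 't) \<Rightarrow> (nat \<Rightarrow> (nat \<Rightarrow> 't) \<Rightarrow> real) \<Rightarrow> nat \<Rightarrow> (nat \<Rightarrow> 's) \<Rightarrow> real" where
  "payoff_s g u i s = u i (g s)"

text \<open>The value of \<open>s\<^sub>n\<close> determined by \<open>t\<^sub>n = g\<^sub>n (s\<^sub>1, \<dots>, s\<^sub>n)\<close> when \<open>s\<close> gives \<open>s\<^sub>1, \<dots>, s\<^sub>n\<^sub>-\<^sub>1\<close>.\<close>

definition last_s ::
    "nat \<Rightarrow> 's set \<Rightarrow> ((nat \<Rightarrow> 's) \<Rightarrow> nat \<Rightarrow> 't) \<Rightarrow> (nat \<Rightarrow> 's) \<Rightarrow> 't \<Rightarrow> 's" where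
  "last_s n S g s t = the_inv_into S (\<lambda>y. g (s(n := y)) n) t"

definition payoff_mixed ::
    "nat \<Rightarrow> 's set \<Rightarrow> ((nat \<Rightarrow> 's) \<Rightarrow> nat \<Rightarrow> 't) \<Rightarrow> (nat \<Rightarrow> (nat \<Rightarrow> 't) \<Rightarrow> real)
      \<Rightarrow> nat \<Rightarrow> (nat \<Rightarrow> 's) \<Rightarrow> 't \<Rightarrow> real" where
  "payoff_mixed n S g u i s t = payoff_s g u i (s(n := last_s n S g s t))"

definition others :: "nat \<Rightarrow> 'a \<Rightarrow> nat \<Rightarrow> 'a" where
  "others n a = (\<lambda>j\<in>{1..<n}. a)"

end

theory Submission
  imports Defs
begin

text \<open>
  Player \<open>n\<close>'s condition is the same in both games, because \<open>t\<^sub>n\<close> merely reparametrises \<open>s\<^sub>n\<close> while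
  the others stay at \<open>s\<^sup>*\<close>. The content lies in the condition of a player \<open>i \<noteq> n\<close>: when \<open>i\<close>
  deviates, a fixed \<open>s\<^sub>n\<close> and a fixed \<open>t\<^sub>n\<close> are different replies of player \<open>n\<close>.

  Keep all players except \<open>i\<close> and \<open>n\<close> at \<open>s\<^sup>*\<close>, and write \<open>F x y\<close> and \<open>G x t\<close> for the payoff of \<open>i\<close>
  as a function of \<open>s\<^sub>i = x\<close> and of \<open>s\<^sub>n = y\<close> or \<open>t\<^sub>n = t\<close>. For each \<open>x\<close>, the functions \<open>F x\<close> and
  \<open>G x\<close> take the same values. Let \<open>V\<close> be the payoff of \<open>i\<close> at the candidate equilibrium. On
  profiles where players \<open>1, \<dots>, n - 1\<close> agree, the game being zero-sum and symmetric makes player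
  \<open>n\<close>'s payoff \<open>-(n - 1)\<close> times that of \<open>i\<close>. So if player \<open>n\<close> is at the optimum, which is unique
  by hypothesis, then \<open>V\<close> is the minimum of \<open>F s\<^sup>*\<close> and of \<open>G s\<^sup>*\<close>, attained only at \<open>s\<^sub>n\<^sup>*\<close> and only
  at \<open>t\<^sub>n\<^sup>0\<close>, respectively (\<open>unique_minimizer_of_payoff\<close>).

  Suppose \<open>F x s\<^sub>n\<^sup>* \<le> V\<close> for all \<open>x\<close>. Then each \<open>x\<close> has some reply \<open>t\<close> with \<open>G x t \<le> V\<close>, and by Sion's
  minimax theorem for \<open>G\<close> (\<open>sion_minimax\<close>) one \<open>t\<close> does for all \<open>x\<close> at once. In particular
  \<open>G s\<^sup>* t \<le> V\<close>, so this \<open>t\<close> is \<open>t\<^sub>n\<^sup>0\<close>. The converse is the same argument with \<open>F\<close> and \<open>G\<close>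
  exchanged; both directions are instances of \<open>unique_best_reply_bounds_payoff\<close>.
\<close>

section \<open>A minimax theorem in topological vector spaces\<close>

lemma tendsto_scaleR_tvs:
  fixes g :: "'b \<Rightarrow> 'a::hausdorff_tvs"
  assumes "(f \<longlongrightarrow> c) F" "(g \<longlongrightarrow> x) F"
  shows "((\<lambda>a. f a *\<^sub>R g a) \<longlongrightarrow> c *\<^sub>R x) F"
  using filterlim_compose[OF tendsto_scaleR_Pair filterlim_Pair[OF assms]] by simp

lemma continuous_on_segment:
  fixes x y :: "'a::hausdorff_tvs"
  shows "continuous_on A (\<lambda>a. (1 - a) *\<^sub>R x + a *\<^sub>R y)"
  unfolding continuous_on_def
  by (intro ballI tendsto_add tendsto_scaleR_tvs tendsto_diff tendsto_const tendsto_ident_at)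

lemma segment_in_convex:
  assumes "convex X" "x \<in> X" "y \<in> X" "a \<in> {0..1::real}"
  shows "(1 - a) *\<^sub>R x + a *\<^sub>R y \<in> X"
  using assms by (auto simp: convex_alt)

text \<open>
  Komiya's argument. If the two sublevel sets were disjoint, then by compactness they would still be
  disjoint at some level \<open>b > V\<close>. Quasi-concavity in \<open>x\<close> puts the \<open>b\<close>-sublevel set of any point \<open>z\<close>
  of the segment from \<open>x1\<close> to \<open>x2\<close> inside the union of those of \<open>x1\<close> and \<open>x2\<close>; being convex, it
  lies in one of the two. Which of them it is depends on \<open>z\<close> in a locally constant way, thanks to
  the gap between \<open>V\<close> and \<open>b\<close>, but changes from one end of the segment to the other.
\<close>

lemma two_sublevel_sets_meet:
  fixes X :: "'a::hausdorff_tvs set" and Y :: "'b::hausdorff_tvs set"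
    and F :: "'a \<Rightarrow> 'b \<Rightarrow> real"
  assumes X: "convex X" and Y: "convex Y" "compact Y"
    and concave: "\<And>y. y \<in> Y \<Longrightarrow> quasiconcave_on X (\<lambda>x. F x y)"
    and convex: "\<And>x. x \<in> X \<Longrightarrow> quasiconvex_on Y (F x)"
    and cont_x: "\<And>y. y \<in> Y \<Longrightarrow> continuous_on X (\<lambda>x. F x y)"
    and cont_y: "\<And>x. x \<in> X \<Longrightarrow> continuous_on Y (F x)"
    and nonempty: "\<And>x. x \<in> X \<Longrightarrow> \<exists>y\<in>Y. F x y \<le> V"
    and x1: "x1 \<in> X" and x2: "x2 \<in> X"
  shows "\<exists>y\<in>Y. F x1 y \<le> V \<and> F x2 y \<le> V"
proof (rule ccontr)
  assume disj: "\<not> (\<exists>y\<in>Y. F x1 y \<le> V \<and> F x2 y \<le> V)"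
  have "Y \<noteq> {}" using nonempty[OF x1] by auto
  moreover have "continuous_on Y (\<lambda>y. max (F x1 y) (F x2 y))"
    by (intro continuous_on_max cont_y x1 x2)
  ultimately obtain y0 where y0: "y0 \<in> Y"
      and min: "\<And>y. y \<in> Y \<Longrightarrow> max (F x1 y0) (F x2 y0) \<le> max (F x1 y) (F x2 y)"
    using continuous_attains_inf[OF Y(2), of "\<lambda>y. max (F x1 y) (F x2 y)"] by blast
  have "\<not> (F x1 y0 \<le> V \<and> F x2 y0 \<le> V)" using disj y0 by blast
  then have V_less: "V < max (F x1 y0) (F x2 y0)" by linarith
  obtain b where b: "V < b" "b < max (F x1 y0) (F x2 y0)"
    using dense[OF V_less] by blast
  have sep: False if "y \<in> Y" "F x1 y \<le> b" "F x2 y \<le> b" for y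
    using min[OF that(1)] b(2) that(2,3) by auto
  define z where "z a = (1 - a) *\<^sub>R x1 + a *\<^sub>R x2" for a
  have zX: "z a \<in> X" if "a \<in> {0..1}" for a
    unfolding z_def using X x1 x2 that by (rule segment_in_convex)
  have cover: "F x1 y \<le> F (z a) y \<or> F x2 y \<le> F (z a) y" if "a \<in> {0..1}" "y \<in> Y" for a y
  proof -
    have "min (F x1 y) (F x2 y) \<le> F (z a) y"
      using concave[OF that(2)] that(1) x1 x2 unfolding quasiconcave_on_def z_def by blast
    then show ?thesis by linarith
  qed
  \<comment> \<open>A segment joining \<open>y1\<close> to \<open>y2\<close> inside the sublevel set of \<open>z a\<close> would be split into two
    disjoint closed pieces.\<close>
  have one_side: False
    if a: "a \<in> {0..1}" and y1: "y1 \<in> Y" "F (z a) y1 \<le> b" "F x1 y1 \<le> b"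
      and y2: "y2 \<in> Y" "F (z a) y2 \<le> b" "F x2 y2 \<le> b" for a y1 y2
  proof -
    define p where "p c = (1 - c) *\<^sub>R y1 + c *\<^sub>R y2" for c
    have pY: "p c \<in> Y" if "c \<in> {0..1}" for c
      unfolding p_def using Y(1) y1(1) y2(1) that by (rule segment_in_convex)
    have "continuous_on {0..1} p"
      unfolding p_def[abs_def] by (rule continuous_on_segment)
    then have "continuous_on {0..1} (\<lambda>c. F x (p c))" if "x \<in> X" for x
      using continuous_on_compose2[OF cont_y[OF that]] pY by blast
    then have closed: "closed {c \<in> {0..1}. F x (p c) \<le> b}" if "x \<in> X" for x
      using that by (intro continuous_on_closed_Collect_le continuous_on_const) auto
    have "F (z a) (p c) \<le> b" if "c \<in> {0..1}" for c
    proof -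
      have "F (z a) (p c) \<le> max (F (z a) y1) (F (z a) y2)"
        using convex[OF zX[OF a]] y1(1) y2(1) that unfolding quasiconvex_on_def p_def by blast
      then show ?thesis using y1(2) y2(2) by auto
    qed
    then have "{0..1} \<subseteq> {c \<in> {0..1}. F x1 (p c) \<le> b} \<union> {c \<in> {0..1}. F x2 (p c) \<le> b}"
      using cover[OF a pY] by fastforce
    moreover have "{c \<in> {0..1}. F x1 (p c) \<le> b} \<inter> {c \<in> {0..1}. F x2 (p c) \<le> b} \<inter> {0..1} = {}"
      using sep pY by blast
    moreover have "0 \<in> {c \<in> {0..1}. F x1 (p c) \<le> b} \<inter> {0..1}"
      using y1 by (simp add: p_def)
    moreover have "1 \<in> {c \<in> {0..1}. F x2 (p c) \<le> b} \<inter> {0..1}"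
      using y2 by (simp add: p_def)
    moreover have "connected {0..1::real}" by (rule connected_Icc)
    ultimately show False
      unfolding connected_closed using closed[OF x1] closed[OF x2] by blast
  qed
  \<comment> \<open>The parameters \<open>a\<close> for which the sublevel set of \<open>z a\<close> meets that of \<open>x\<close>. The strict inequality
    makes this set open, and \<open>V < b\<close> ensures that \<open>I x1\<close> and \<open>I x2\<close> still cover \<open>{0..1}\<close>.\<close>
  define I where "I x = (\<Union>y\<in>{y \<in> Y. F x y \<le> b}. {0..1} \<inter> (\<lambda>a. F (z a) y) -` {..<b})" for x
  have "continuous_on {0..1} z"
    unfolding z_def[abs_def] by (rule continuous_on_segment)
  then have "continuous_on {0..1} (\<lambda>a. F (z a) y)" if "y \<in> Y" for y
    using continuous_on_compose2[OF cont_x[OF that]] zX by blast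
  then have "openin (top_of_set {0..1}) ({0..1} \<inter> (\<lambda>a. F (z a) y) -` {..<b})" if "y \<in> Y" for y
    using continuous_openin_preimage_gen[OF _ open_lessThan] that by blast
  then have "openin (top_of_set {0..1}) (I x)" for x
    unfolding I_def by blast
  moreover have "{0..1} \<subseteq> I x1 \<union> I x2"
  proof
    fix a :: real assume a: "a \<in> {0..1}"
    obtain y where y: "y \<in> Y" "F (z a) y \<le> V" using nonempty zX[OF a] by blast
    with b(1) cover[OF a y(1)] a show "a \<in> I x1 \<union> I x2" by (force simp: I_def)
  qed
  moreover have "I x1 \<inter> I x2 = {}"
  proof -
    have False if "a \<in> I x1" "a \<in> I x2" for a
      using that one_side[of a] unfolding I_def by (auto dest!: less_imp_le)
    then show ?thesis by blast
  qed
  moreover have "0 \<in> I x1"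
    using nonempty[OF x1] b(1) by (force simp: I_def z_def)
  moreover have "1 \<in> I x2"
    using nonempty[OF x2] b(1) by (force simp: I_def z_def)
  moreover have "connected {0..1::real}" by (rule connected_Icc)
  ultimately show False
    unfolding connected_openin by blast
qed

text \<open>
  The induction shrinks \<open>Y\<close> to the sublevel set of one point: by the case of two points, every
  \<open>x \<in> X\<close> still has a reply in the smaller set, so all hypotheses persist.
\<close>

lemma finitely_many_sublevel_sets_meet:
  fixes X :: "'a::hausdorff_tvs set" and Y :: "'b::hausdorff_tvs set"
    and F :: "'a \<Rightarrow> 'b \<Rightarrow> real"
  assumes "finite A" "A \<subseteq> X" and X: "X \<noteq> {}" "convex X" and Y: "convex Y" "compact Y"
    and concave: "\<And>y. y \<in> Y \<Longrightarrow> quasiconcave_on X (\<lambda>x. F x y)"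
    and convex: "\<And>x. x \<in> X \<Longrightarrow> quasiconvex_on Y (F x)"
    and cont_x: "\<And>y. y \<in> Y \<Longrightarrow> continuous_on X (\<lambda>x. F x y)"
    and cont_y: "\<And>x. x \<in> X \<Longrightarrow> continuous_on Y (F x)"
    and nonempty: "\<And>x. x \<in> X \<Longrightarrow> \<exists>y\<in>Y. F x y \<le> V"
  shows "\<exists>y\<in>Y. \<forall>x\<in>A. F x y \<le> V"
  using assms(1,2) Y concave convex cont_x cont_y nonempty
proof (induction A arbitrary: Y rule: finite_induct)
  case empty
  then show ?case using X by auto
next
  case (insert x0 A Y)
  note concave = insert.prems(4) and convex = insert.prems(5)
    and cont_x = insert.prems(6) and cont_y = insert.prems(7)
  define Y' where "Y' = {y \<in> Y. F x0 y \<le> V}"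
  have x0: "x0 \<in> X" and "A \<subseteq> X" using insert.prems(1) by auto
  have "closed Y" using insert.prems(3) by (rule compact_imp_closed)
  then have "closed Y'"
    unfolding Y'_def by (intro continuous_on_closed_Collect_le continuous_on_const cont_y x0)
  then have "compact (Y \<inter> Y')" by (rule compact_Int_closed[OF insert.prems(3)])
  moreover have sub: "Y' \<subseteq> Y" by (auto simp: Y'_def)
  ultimately have "compact Y'" by (simp add: Int_absorb1)
  moreover have "convex Y'"
    unfolding convex_alt
  proof (intro ballI allI impI)
    fix p q and a :: real assume pq: "p \<in> Y'" "q \<in> Y'" and "0 \<le> a \<and> a \<le> 1"
    then have a: "a \<in> {0..1}" by simp
    have "F x0 ((1 - a) *\<^sub>R p + a *\<^sub>R q) \<le> max (F x0 p) (F x0 q)"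
      using convex[OF x0] pq sub a unfolding quasiconvex_on_def by blast
    then show "(1 - a) *\<^sub>R p + a *\<^sub>R q \<in> Y'"
      using pq segment_in_convex[OF insert.prems(2) _ _ a] by (auto simp: Y'_def)
  qed
  moreover have "\<exists>y\<in>Y'. F x y \<le> V" if "x \<in> X" for x
    using two_sublevel_sets_meet[OF X(2) insert.prems(2-8) x0 that]
    by (auto simp: Y'_def)
  moreover have "quasiconvex_on Y' (F x)" if "x \<in> X" for x
    using convex[OF that] sub unfolding quasiconvex_on_def by blast
  moreover have "continuous_on Y' (F x)" if "x \<in> X" for x
    using cont_y[OF that] sub by (rule continuous_on_subset)
  ultimately have "\<exists>y\<in>Y'. \<forall>x\<in>A. F x y \<le> V"
    using concave cont_x sub \<open>A \<subseteq> X\<close> by (intro insert.IH) auto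
  then show ?case by (auto simp: Y'_def)
qed

text \<open>
  This is the nontrivial inequality \<open>min\<^sub>y sup\<^sub>x F \<le> sup\<^sub>x min\<^sub>y F\<close> of Sion's theorem, phrased by means
  of a common upper bound \<open>V\<close>. Compactness of \<open>Y\<close> reduces it to finitely many \<open>x\<close>.
\<close>

theorem sion_minimax:
  fixes X :: "'a::hausdorff_tvs set" and Y :: "'b::hausdorff_tvs set"
    and F :: "'a \<Rightarrow> 'b \<Rightarrow> real"
  assumes X: "X \<noteq> {}" "convex X" and Y: "convex Y" "compact Y"
    and concave: "\<And>y. y \<in> Y \<Longrightarrow> quasiconcave_on X (\<lambda>x. F x y)"
    and convex: "\<And>x. x \<in> X \<Longrightarrow> quasiconvex_on Y (F x)"
    and cont_x: "\<And>y. y \<in> Y \<Longrightarrow> continuous_on X (\<lambda>x. F x y)"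
    and cont_y: "\<And>x. x \<in> X \<Longrightarrow> continuous_on Y (F x)"
    and nonempty: "\<And>x. x \<in> X \<Longrightarrow> \<exists>y\<in>Y. F x y \<le> V"
  shows "\<exists>y\<in>Y. \<forall>x\<in>X. F x y \<le> V"
proof -
  have "Y \<inter> (\<Inter>x\<in>X. {y \<in> Y. F x y \<le> V}) \<noteq> {}"
  proof (rule compact_imp_fip_image[OF Y(2)])
    fix x assume "x \<in> X"
    then show "closed {y \<in> Y. F x y \<le> V}"
      by (intro continuous_on_closed_Collect_le continuous_on_const cont_y
          compact_imp_closed[OF Y(2)])
  next
    fix A assume "finite A" "A \<subseteq> X"
    from finitely_many_sublevel_sets_meet[OF this assms]
    show "Y \<inter> (\<Inter>x\<in>A. {y \<in> Y. F x y \<le> V}) \<noteq> {}" by auto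
  qed
  then show ?thesis by auto
qed

text \<open>
  The reply that the minimax theorem yields keeps the payoff at \<open>x0\<close> within \<open>V\<close>, so uniqueness
  identifies it with \<open>y0\<close>.
\<close>

corollary unique_best_reply_bounds_payoff:
  fixes X :: "'a::hausdorff_tvs set" and Y :: "'b::hausdorff_tvs set"
    and F :: "'a \<Rightarrow> 'b \<Rightarrow> real"
  assumes X: "convex X" and Y: "convex Y" "compact Y"
    and concave: "\<And>y. y \<in> Y \<Longrightarrow> quasiconcave_on X (\<lambda>x. F x y)"
    and convex: "\<And>x. x \<in> X \<Longrightarrow> quasiconvex_on Y (F x)"
    and cont: "continuous_on (X \<times> Y) (\<lambda>(x, y). F x y)"
    and reply: "\<And>x. x \<in> X \<Longrightarrow> \<exists>y\<in>Y. F x y \<le> V"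
    and x0: "x0 \<in> X" and unique: "\<And>y. y \<in> Y \<Longrightarrow> F x0 y \<le> V \<Longrightarrow> y = y0"
    and x: "x \<in> X"
  shows "F x y0 \<le> V"
proof -
  have "continuous_on X (\<lambda>x. F x y)" if "y \<in> Y" for y
  proof -
    have "continuous_on X (\<lambda>x. (x, y))"
      by (intro continuous_on_Pair continuous_on_id continuous_on_const)
    from continuous_on_compose2[OF cont this] show ?thesis using that by auto
  qed
  moreover have "continuous_on Y (F x)" if "x \<in> X" for x
  proof -
    have "continuous_on Y (\<lambda>y. (x, y))"
      by (intro continuous_on_Pair continuous_on_id continuous_on_const)
    from continuous_on_compose2[OF cont this] show ?thesis using that by auto
  qed
  ultimately obtain y where "y \<in> Y" "\<forall>x\<in>X. F x y \<le> V"
    using sion_minimax[of X Y F V] X Y concave convex reply x0 by blast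
  then show ?thesis using unique x0 x by blast
qed

section \<open>Payoffs in the partially symmetric game\<close>

lemma others_upd_mem: "a \<in> X \<Longrightarrow> i \<in> {1..<n} \<Longrightarrow> x \<in> X \<Longrightarrow> (others n a)(i := x) \<in> {1..<n} \<rightarrow>\<^sub>E X"
  by (auto simp: others_def PiE_iff extensional_def)

lemma profile_upd_last_mem:
  fixes n :: nat
  assumes "p \<in> {1..<n} \<rightarrow>\<^sub>E X" "y \<in> X" "1 \<le> n"
  shows "p(n := y) \<in> {1..n} \<rightarrow>\<^sub>E X"
  using assms by (auto simp: PiE_iff extensional_def)

lemma others_mem: "a \<in> X \<Longrightarrow> others n a \<in> {1..<n} \<rightarrow>\<^sub>E X"
  by (auto simp: others_def)

lemma others_upd_same: "i \<in> {1..<n} \<Longrightarrow> (others n a)(i := a) = others n a"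
  by (auto simp: others_def fun_eq_iff)

text \<open>The transposition of \<open>i\<close> and \<open>j\<close> leaves a profile in which players \<open>1, \<dots>, n - 1\<close> agree unchanged.\<close>

lemma symmetric_payoffs_eq:
  assumes sym: "symmetric_except_last n X w" and a: "a \<in> X" and y: "y \<in> X"
    and i: "i \<in> {1..<n}" and j: "j \<in> {1..<n}"
  shows "w j ((others n a)(n := y)) = w i ((others n a)(n := y))"
proof -
  let ?x = "(others n a)(n := y)" and ?\<sigma> = "Transposition.transpose i j"
  have perm: "?\<sigma> permutes {1..n}" using i j by (intro permutes_swap_id) auto
  have fix_n: "?\<sigma> n = n" using i j by (simp add: Transposition.transpose_def)
  have x: "?x \<in> {1..n} \<rightarrow>\<^sub>E X"
    using i y by (intro profile_upd_last_mem others_mem a) auto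
  have "?x (?\<sigma> k) = ?x k" if "k \<in> {1..n}" for k
    using i j that by (auto simp: others_def Transposition.transpose_def)
  moreover have i_mem: "i \<in> {1..n}" using i by simp
  ultimately have "w (?\<sigma> i) ?x = w i ?x"
    using sym perm fix_n x i_mem unfolding symmetric_except_last_def by blast
  then show ?thesis by simp
qed

lemma last_payoff_eq:
  assumes sym: "symmetric_except_last n X w"
    and zero: "\<And>x. x \<in> {1..n} \<rightarrow>\<^sub>E X \<Longrightarrow> (\<Sum>i\<in>{1..n}. w i x) = 0"
    and a: "a \<in> X" and y: "y \<in> X" and i: "i \<in> {1..<n}"
  shows "w n ((others n a)(n := y)) = - real (n - 1) * w i ((others n a)(n := y))"
proof -
  let ?x = "(others n a)(n := y)"
  have x: "?x \<in> {1..n} \<rightarrow>\<^sub>E X"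
    using i y by (intro profile_upd_last_mem others_mem a) auto
  have "{1..n} = insert n {1..<n}" using i by auto
  then have "w n ?x + (\<Sum>j\<in>{1..<n}. w j ?x) = 0" using zero[OF x] by simp
  moreover have "(\<Sum>j\<in>{1..<n}. w j ?x) = (\<Sum>j\<in>{1..<n}. w i ?x)"
    using symmetric_payoffs_eq[OF sym a y i] by (intro sum.cong) auto
  ultimately show ?thesis by simp
qed

text \<open>
  Since player \<open>n\<close>'s payoff is a negative multiple of that of \<open>i\<close>, a choice of player \<open>n\<close> that is no
  better for \<open>i\<close> than \<open>b\<close> is as good for \<open>n\<close> as \<open>b\<close>, hence another maximiser.
\<close>

lemma unique_minimizer_of_payoff:
  assumes sym: "symmetric_except_last n X w"
    and zero: "\<And>x. x \<in> {1..n} \<rightarrow>\<^sub>E X \<Longrightarrow> (\<Sum>i\<in>{1..n}. w i x) = 0"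
    and a: "a \<in> X" and i: "i \<in> {1..<n}"
    and unique: "\<exists>!y. is_arg_max (\<lambda>y. w n ((others n a)(n := y))) (\<lambda>y. y \<in> X) y"
    and b: "b \<in> X" and best: "\<And>y. y \<in> X \<Longrightarrow> w n ((others n a)(n := y)) \<le> w n ((others n a)(n := b))"
    and y: "y \<in> X" and le: "w i ((others n a)(n := y)) \<le> w i ((others n a)(n := b))"
  shows "y = b"
proof -
  have "w n ((others n a)(n := b)) \<le> w n ((others n a)(n := y))"
    using mult_left_mono[OF le, of "real (n - 1)"] last_payoff_eq[OF sym zero a b i]
      last_payoff_eq[OF sym zero a y i] by simp
  then have "is_arg_max (\<lambda>y. w n ((others n a)(n := y))) (\<lambda>y. y \<in> X) y"
    using best y by (fastforce simp: is_arg_max_def)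
  moreover have "is_arg_max (\<lambda>y. w n ((others n a)(n := y))) (\<lambda>y. y \<in> X) b"
    using best b by (fastforce simp: is_arg_max_def)
  ultimately show ?thesis using unique by blast
qed

lemma continuous_on_upd2:
  assumes "i \<noteq> n"
  shows "continuous_on A (\<lambda>(x, y). p(i := x, n := y))"
proof -
  have "continuous_on A (\<lambda>z. (p(i := fst z, n := snd z)) k)" for k
    by (cases "k = n"; cases "k = i") (auto intro!: continuous_intros)
  then show ?thesis
    unfolding case_prod_beta by (rule continuous_on_coordinatewise_then_product)
qed

lemma last_s_mem:
  assumes "bij_betw (\<lambda>y. g (p(n := y)) n) S T" "t \<in> T"
  shows "last_s n S g p t \<in> S"
  using the_inv_into_into[of "\<lambda>y. g (p(n := y)) n" S t S] assms
  by (auto simp: last_s_def bij_betw_def)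

lemma last_s_image:
  assumes "bij_betw (\<lambda>y. g (p(n := y)) n) S T"
  shows "last_s n S g p ` T = S"
  using bij_betw_the_inv_into[OF assms] by (simp add: last_s_def[abs_def] bij_betw_def)

lemma last_s_eq:
  assumes "bij_betw (\<lambda>y. g (p(n := y)) n) S T" "y \<in> S"
  shows "last_s n S g p (g (p(n := y)) n) = y"
  using the_inv_into_f_f[of "\<lambda>y. g (p(n := y)) n" S y] assms
  by (simp add: last_s_def bij_betw_def)

text \<open>
  The map \<open>(x, y) \<mapsto> (x, t\<^sub>n)\<close> is a continuous bijection from the compact \<open>S \<times> S\<close> to the Hausdorff
  \<open>S \<times> T\<close>, so its inverse is continuous, and \<open>s\<^sub>n\<close> is the second component of the inverse.
\<close>

lemma continuous_on_last_s:
  fixes S :: "'s::hausdorff_tvs set" and T :: "'t::hausdorff_tvs set"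
  assumes S: "compact S"
    and cont: "continuous_on (S \<times> S) (\<lambda>(x, y). g (p(i := x, n := y)) n)"
    and bij: "\<And>x. x \<in> S \<Longrightarrow> bij_betw (\<lambda>y. g (p(i := x, n := y)) n) S T"
  shows "continuous_on (S \<times> T) (\<lambda>(x, t). last_s n S g (p(i := x)) t)"
proof -
  define \<phi> where "\<phi> = (\<lambda>(x, y). (x, g (p(i := x, n := y)) n))"
  define \<psi> where "\<psi> = (\<lambda>(x, t). (x, last_s n S g (p(i := x)) t))"
  have "continuous_on (S \<times> S) \<phi>"
    unfolding \<phi>_def case_prod_beta
    using cont by (intro continuous_on_Pair continuous_on_fst continuous_on_id) (simp add: case_prod_beta)
  then have "continuous_on (\<phi> ` (S \<times> S)) \<psi>"
  proof (rule continuous_on_inv)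
    show "compact (S \<times> S)" using S by (intro compact_Times)
    show "\<forall>z\<in>S \<times> S. \<psi> (\<phi> z) = z"
      using last_s_eq[of g "p(i := _)" n S T, OF bij] by (auto simp: \<phi>_def \<psi>_def)
  qed
  moreover have "\<phi> ` (S \<times> S) = S \<times> T"
    using bij by (fastforce simp: \<phi>_def bij_betw_def image_iff)
  ultimately have "continuous_on (S \<times> T) (\<lambda>z. snd (\<psi> z))"
    by (intro continuous_on_snd) simp
  then show ?thesis by (simp add: \<psi>_def case_prod_beta)
qed

lemma is_max_over_cong: "h ` X = h' ` X' \<Longrightarrow> is_max_over m h X \<longleftrightarrow> is_max_over m h' X'"
  unfolding is_max_over_def by (metis image_iff)

theorem theorem2:
  fixes n :: nat
    and T :: "'t::hausdorff_tvs set"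
    and S :: "'s::hausdorff_tvs set"
    and f :: "(nat \<Rightarrow> 't) \<Rightarrow> nat \<Rightarrow> 's"
    and g :: "(nat \<Rightarrow> 's) \<Rightarrow> nat \<Rightarrow> 't"
    and u :: "nat \<Rightarrow> (nat \<Rightarrow> 't) \<Rightarrow> real"
    and s_star s_n_star :: 's
    and t_n_0 :: 't
  assumes n: "n \<ge> 3"
    and T: "T \<noteq> {}" "convex T" "compact T"
    and S: "S \<noteq> {}" "convex S" "compact S"
    and fg: "homeomorphism ({1..n} \<rightarrow>\<^sub>E T) ({1..n} \<rightarrow>\<^sub>E S) f g"
    and last_bij: "\<And>s. s \<in> {1..<n} \<rightarrow>\<^sub>E S \<Longrightarrow> bij_betw (\<lambda>y. g (s(n := y)) n) S T"
    and u_cont: "\<And>i. i \<in> {1..n} \<Longrightarrow> continuous_on ({1..n} \<rightarrow>\<^sub>E T) (u i)"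
    and quasi_t: "quasi_payoffs n T u"
    and quasi_s: "quasi_payoffs n S (payoff_s g u)"
    and quasi_mixed: "quasi_payoffs_mixed n S T (payoff_mixed n S g u)"
    and zero_sum: "\<And>t. t \<in> {1..n} \<rightarrow>\<^sub>E T \<Longrightarrow> (\<Sum>i\<in>{1..n}. u i t) = 0"
    and sym_t: "symmetric_except_last n T u"
    and sym_s: "symmetric_except_last n S (payoff_s g u)"
    and argmax_unique: "\<And>s. s \<in> S \<Longrightarrow>
          \<exists>!y. is_arg_max (\<lambda>y. payoff_s g u n ((others n s)(n := y))) (\<lambda>y. y \<in> S) y"
    and argmax_cont: "continuous_on S
          (\<lambda>s. arg_max (\<lambda>y. payoff_s g u n ((others n s)(n := y))) (\<lambda>y. y \<in> S))"
    and s_star: "s_star \<in> S"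
    and s_n_star: "s_n_star \<in> S"
    and t_n_0: "t_n_0 = g ((others n s_star)(n := s_n_star)) n"
  shows "last_s n S g (others n s_star) t_n_0 = s_n_star \<and>
    ((\<forall>i\<in>{1..<n}.
        is_max_over (payoff_s g u i ((others n s_star)(n := s_n_star)))
          (\<lambda>y. payoff_s g u i ((others n s_star)(i := y, n := s_n_star))) S) \<and>
      is_max_over (payoff_s g u n ((others n s_star)(n := s_n_star)))
        (\<lambda>y. payoff_s g u n ((others n s_star)(n := y))) S
     \<longleftrightarrow>
     (\<forall>i\<in>{1..<n}.
        is_max_over (payoff_s g u i ((others n s_star)(n := s_n_star)))
          (\<lambda>y. payoff_mixed n S g u i ((others n s_star)(i := y)) t_n_0) S) \<and>
      is_max_over (payoff_s g u n ((others n s_star)(n := s_n_star)))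
        (\<lambda>t. payoff_mixed n S g u n (others n s_star) t) T)"
proof -
  let ?v = "payoff_s g u" and ?o = "others n s_star"
  have g_cont: "continuous_on ({1..n} \<rightarrow>\<^sub>E S) g" and g_mem: "\<And>s. s \<in> {1..n} \<rightarrow>\<^sub>E S \<Longrightarrow> g s \<in> {1..n} \<rightarrow>\<^sub>E T"
    using fg by (auto simp: homeomorphism_def)
  have v_cont: "continuous_on ({1..n} \<rightarrow>\<^sub>E S) (?v i)" if "i \<in> {1..n}" for i
    unfolding payoff_s_def[abs_def]
    using continuous_on_compose2[OF u_cont[OF that] g_cont] g_mem by blast
  have zero_s: "(\<Sum>i\<in>{1..n}. ?v i s) = 0" if "s \<in> {1..n} \<rightarrow>\<^sub>E S" for s
    using zero_sum[OF g_mem[OF that]] by (simp add: payoff_s_def)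
  have o_mem: "?o \<in> {1..<n} \<rightarrow>\<^sub>E S" using s_star by (rule others_mem)
  have t0_mem: "t_n_0 \<in> T"
    unfolding t_n_0 using last_bij[OF o_mem] s_n_star by (auto simp: bij_betw_def)
  have last: "last_s n S g ?o t_n_0 = s_n_star"
    unfolding t_n_0 by (rule last_s_eq[of g ?o n S T, OF last_bij[OF o_mem] s_n_star])
  have "(\<lambda>t. payoff_mixed n S g u n ?o t) ` T = (\<lambda>y. ?v n (?o(n := y))) ` (last_s n S g ?o ` T)"
    by (simp add: payoff_mixed_def image_image)
  then have last_player: "is_max_over m (\<lambda>y. ?v n (?o(n := y))) S
      \<longleftrightarrow> is_max_over m (\<lambda>t. payoff_mixed n S g u n ?o t) T" for m
    by (intro is_max_over_cong) (simp add: last_s_image[of g ?o n S T, OF last_bij[OF o_mem]])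
  have other_players: "is_max_over (?v i (?o(n := s_n_star))) (\<lambda>y. ?v i (?o(i := y, n := s_n_star))) S
      \<longleftrightarrow> is_max_over (?v i (?o(n := s_n_star))) (\<lambda>y. payoff_mixed n S g u i (?o(i := y)) t_n_0) S"
    if i: "i \<in> {1..<n}" and
      best: "is_max_over (?v n (?o(n := s_n_star))) (\<lambda>y. ?v n (?o(n := y))) S" for i
  proof -
    define F where "F x y = ?v i (?o(i := x, n := y))" for x y
    define G where "G x t = payoff_mixed n S g u i (?o(i := x)) t" for x t
    define V where "V = ?v i (?o(n := s_n_star))"
    note same = others_upd_same[OF i, of s_star]
    have bij: "bij_betw (\<lambda>y. g (?o(i := x, n := y)) n) S T" if "x \<in> S" for x
      by (rule last_bij) (rule others_upd_mem[OF s_star i that])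
    have mem: "?o(i := x, n := y) \<in> {1..n} \<rightarrow>\<^sub>E S" if "x \<in> S" "y \<in> S" for x y
      using others_upd_mem[OF s_star i that(1)] that(2) n by (intro profile_upd_last_mem) auto
    have G_F: "G x t = F x (last_s n S g (?o(i := x)) t)" for x t
      by (simp add: F_def G_def payoff_mixed_def)
    have V_F: "F s_star s_n_star = V" and V_G: "G s_star t_n_0 = V"
      using last by (simp_all add: G_F) (simp_all add: F_def V_def same)
    have i_ne: "i \<noteq> n" and i_mem: "i \<in> {1..n}" using i by auto
    have upd_cont: "continuous_on (S \<times> S) (\<lambda>z. ?o(i := fst z, n := snd z))"
      using continuous_on_upd2[OF i_ne, of "S \<times> S" ?o] by (simp add: case_prod_beta)
    have upd_sub: "(\<lambda>z. ?o(i := fst z, n := snd z)) ` (S \<times> S) \<subseteq> {1..n} \<rightarrow>\<^sub>E S"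
      using mem by (intro image_subsetI) (metis mem_Times_iff)
    have F_cont: "continuous_on (S \<times> S) (\<lambda>(x, y). F x y)"
      unfolding F_def case_prod_beta
      using continuous_on_compose2[OF v_cont[OF i_mem] upd_cont upd_sub] .
    have "continuous_on (S \<times> S) (\<lambda>z. g (?o(i := fst z, n := snd z)))"
      using continuous_on_compose2[OF g_cont upd_cont upd_sub] .
    then have "continuous_on (S \<times> S) (\<lambda>(x, y). g (?o(i := x, n := y)) n)"
      unfolding case_prod_beta by (rule continuous_on_product_then_coordinatewise)
    then have last_cont: "continuous_on (S \<times> T) (\<lambda>(x, t). last_s n S g (?o(i := x)) t)"
      by (rule continuous_on_last_s[OF S(3)]) (rule bij)
    have last_mem: "last_s n S g (?o(i := x)) t \<in> S" if "x \<in> S" "t \<in> T" for x t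
      by (rule last_s_mem[of g _ n S T, OF bij[OF that(1)] that(2)])
    have G_cont: "continuous_on (S \<times> T) (\<lambda>(x, t). G x t)"
    proof -
      have "continuous_on (S \<times> T) (\<lambda>z. (fst z, last_s n S g (?o(i := fst z)) (snd z)))"
        using last_cont by (intro continuous_intros) (simp add: case_prod_beta)
      moreover have "(\<lambda>z. (fst z, last_s n S g (?o(i := fst z)) (snd z))) ` (S \<times> T) \<subseteq> S \<times> S"
        using last_mem by (intro image_subsetI) (simp add: mem_Times_iff)
      ultimately show ?thesis
        using continuous_on_compose2[OF F_cont] by (fastforce simp: G_F case_prod_beta)
    qed
    have F_concave: "quasiconcave_on S (\<lambda>x. F x y)" if y: "y \<in> S" for y
    proof -
      have "?o(n := y) \<in> {1..n} \<rightarrow>\<^sub>E S"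
        using n o_mem y by (intro profile_upd_last_mem) auto
      then have "quasiconcave_on S (\<lambda>x. ?v i (?o(n := y, i := x)))"
        using quasi_s i_mem unfolding quasi_payoffs_def by blast
      then show ?thesis using i_ne by (simp add: F_def fun_upd_twist)
    qed
    have F_convex: "quasiconvex_on S (F x)" if x: "x \<in> S" for x
    proof -
      have n_mem: "n \<in> {1..n} - {i}" using n i_ne by simp
      have "quasiconvex_on S (\<lambda>y. ?v i ((?o(i := x, n := s_n_star))(n := y)))"
        using quasi_s i_mem n_mem mem[OF x s_n_star] unfolding quasi_payoffs_def by blast
      then show ?thesis by (simp add: F_def[abs_def])
    qed
    have G_concave: "quasiconcave_on S (\<lambda>x. G x t)" if "t \<in> T" for t
      using quasi_mixed o_mem that i unfolding quasi_payoffs_mixed_def G_def by blast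
    have G_convex: "quasiconvex_on T (G x)" if "x \<in> S" for x
      using quasi_mixed others_upd_mem[OF s_star i that] i
      unfolding quasi_payoffs_mixed_def G_def[abs_def] using t0_mem by blast
    have unique_F: "y = s_n_star" if "y \<in> S" "F s_star y \<le> V" for y
    proof (rule unique_minimizer_of_payoff[OF sym_s zero_s s_star i argmax_unique[OF s_star] s_n_star])
      show "?v n (?o(n := y)) \<le> ?v n (?o(n := s_n_star))" if "y \<in> S" for y
        using best that by (auto simp: is_max_over_def)
      show "?v i (?o(n := y)) \<le> ?v i (?o(n := s_n_star))"
        using that(2) same by (simp add: F_def V_def)
    qed (use that in auto)
    have unique_G: "t = t_n_0" if "t \<in> T" "G s_star t \<le> V" for t
    proof -
      have "last_s n S g ?o t = s_n_star"
        using that last_mem[OF s_star that(1)] by (intro unique_F) (simp_all add: G_F same)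
      then show ?thesis
        using last last_bij[OF o_mem] bij_betw_the_inv_into[OF last_bij[OF o_mem]] that(1) t0_mem
        unfolding last_s_def bij_betw_def inj_on_def by metis
    qed
    have "(\<forall>x\<in>S. F x s_n_star \<le> V) \<longleftrightarrow> (\<forall>x\<in>S. G x t_n_0 \<le> V)"
    proof
      assume F: "\<forall>x\<in>S. F x s_n_star \<le> V"
      have "\<exists>t\<in>T. G x t \<le> V" if "x \<in> S" for x
      proof
        have "last_s n S g (?o(i := x)) (g (?o(i := x, n := s_n_star)) n) = s_n_star"
          by (rule last_s_eq[of g _ n S T, OF bij[OF that] s_n_star])
        then show "G x (g (?o(i := x, n := s_n_star)) n) \<le> V"
          using F that by (simp add: G_F)
        show "g (?o(i := x, n := s_n_star)) n \<in> T"
          using bij[OF that] s_n_star by (auto simp: bij_betw_def)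
      qed
      then show "\<forall>x\<in>S. G x t_n_0 \<le> V"
        using unique_best_reply_bounds_payoff[OF S(2) T(2,3) G_concave G_convex G_cont _ s_star unique_G]
        by blast
    next
      assume G: "\<forall>x\<in>S. G x t_n_0 \<le> V"
      have "\<exists>y\<in>S. F x y \<le> V" if "x \<in> S" for x
        using G that last_mem[OF that t0_mem] by (auto simp: G_F)
      then show "\<forall>x\<in>S. F x s_n_star \<le> V"
        using unique_best_reply_bounds_payoff[OF S(2) S(2,3) F_concave F_convex F_cont _ s_star unique_F]
        by blast
    qed
    moreover have "V \<in> (\<lambda>x. F x s_n_star) ` S"
      by (rule rev_image_eqI[OF s_star]) (simp add: V_F)
    moreover have "V \<in> (\<lambda>x. G x t_n_0) ` S"
      by (rule rev_image_eqI[OF s_star]) (simp add: V_G)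
    ultimately show ?thesis
      unfolding is_max_over_def F_def[symmetric] G_def[symmetric] V_def[symmetric] by simp
  qed
  show ?thesis
    using last last_player other_players by blast
qed

end
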